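(* Let $\Gamma$ be a countable discrete group, $(\Omega,\nu)$ a separable probability space and $\sigma$ an ergodic p.m.p. action of $\Gamma$ on $(\Omega,\nu)$. If the group $B^1(\sigma;\mathbb{T})$ of $\mathbb{T}$-valued $1$-coboundaries is closed in the topological group $Z^1(\sigma;\mathbb{T})$ of $\mathbb{T}$-valued $1$-cocycles, then $\sigma$ is strongly ergodic.
   Context: A measure space $(\Omega,\nu)$ is separable if the space of measurable subsets of $\Omega$ is separable with respect to the distance $\nu(A\triangle B)$. A p.m.p. (probability measure preserving) action $\sigma$ of $\Gamma$ on a probability space $(\Omega,\nu)$ is a group homomorphism $t\mapsto\sigma_t$ from $\Gamma$ to the group of bi-measurable transformations of $\Omega$ such that each $\sigma_t$ preserves $\nu$; write $t.\omega=\sigma_t(\omega)$. A measurable set $A\subset\Omega$ is $\Gamma$-invariant if $\nu(t.A\triangle A)=0$ for all $t\in\Gamma$. The action is ergodic if every $\Gamma$-invariant measurable set is null or co-null. A sequence $(A_n)_{n\geq 1}$ of measurable sets is asymptotically $\Gamma$-invariant if $\nu(t.A_n\triangle A_n)\to 0$ for all $t\in\Gamma$; it is trivially so if $\liminf_n \nu(A_n)\nu(A_n^{\complement})=0$. The action is strongly ergodic if every asymptotically $\Gamma$-invariant sequence is trivial, i.e. satisfies $\liminf_n \nu(A_n)\nu(A_n^{\complement})=0$. $\mathbb{T}$ is the unit circle in $\mathbb{C}$. $L^0(\Omega,\nu;\mathbb{T})$ is the group of (a.e.-equivalence classes of) measurable functions $\Omega\to\mathbb{T}$ under pointwise multiplication,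 with the topology of convergence in measure, generated by the sets $\{\varphi : \nu(\{|\varphi-\varphi_0|\geq\varepsilon\})<\varepsilon\}$ for $\varphi_0\in L^0(\Omega,\nu;\mathbb{T})$, $\varepsilon>0$. A ($\mathbb{T}$-valued) $1$-cocycle for $\sigma$ is a map $c:\Gamma\times\Omega\to\mathbb{T}$ with each $c_t=c(t,\cdot)$ measurable and, for every $s,t\in\Gamma$ and almost every $\omega\in\Omega$, $c_{st}(\omega)=c_s(\omega)c_t(s^{-1}.\omega)$. The set $Z^1(\sigma;\mathbb{T})$ of all $1$-cocycles is a group under pointwise multiplication; it is identified, via $c\mapsto(c_t)_{t\in\Gamma}$, with a subgroup of $L^0(\Omega,\nu;\mathbb{T})^{\Gamma}$ and carries the topology induced from the product topology. For $\varphi\in L^0(\Omega,\nu;\mathbb{T})$, the $1$-cocycle $b_\varphi(t,\omega)=\varphi(\omega)/\varphi(t^{-1}.\omega)$ is called a $1$-coboundary, and $B^1(\sigma;\mathbb{T})=\{b_\varphi:\varphi\in L^0(\Omega,\nu;\mathbb{T})\}$ is a subgroup of $Z^1(\sigma;\mathbb{T})$. *)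

theory Defs
  imports "HOL-Probability.Probability" "HOL-Algebra.Group_Action"
begin

text \<open>
  Throughout, \<open>M\<close> is the measure space \<open>(\<Omega>, \<nu>)\<close> with \<open>\<Omega> = space M\<close>, and \<open>G\<close> is the group
  \<open>\<Gamma>\<close>. Discreteness of \<open>\<Gamma>\<close> means that no topology on it is taken into account.
\<close>

section \<open>Separability and actions\<close>

definition separable_measure :: "'a measure \<Rightarrow> bool" where
  "separable_measure M \<longleftrightarrow>
     (\<exists>D. countable D \<and> D \<subseteq> sets M \<and>
          (\<forall>A\<in>sets M. \<forall>\<epsilon>>0. \<exists>B\<in>D. measure M (sym_diff A B) < \<epsilon>))"

text \<open>
  The library's \<^const>\<open>group_action\<close> says that \<open>\<sigma>\<close> is a group homomorphism from \<open>G\<close> to the bijections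
  of \<^term>\<open>space M\<close>, composed pointwise and everywhere (not merely almost everywhere).
\<close>

definition pmp_action :: "('g, 'b) monoid_scheme \<Rightarrow> 'a measure \<Rightarrow> ('g \<Rightarrow> 'a \<Rightarrow> 'a) \<Rightarrow> bool" where
  "pmp_action G M \<sigma> \<longleftrightarrow>
     group_action G (space M) \<sigma> \<and>
     (\<forall>t\<in>carrier G. \<sigma> t \<in> M \<rightarrow>\<^sub>M M \<and> inv_into (space M) (\<sigma> t) \<in> M \<rightarrow>\<^sub>M M \<and> distr M M (\<sigma> t) = M)"

definition invariant_set ::
    "('g, 'b) monoid_scheme \<Rightarrow> 'a measure \<Rightarrow> ('g \<Rightarrow> 'a \<Rightarrow> 'a) \<Rightarrow> 'a set \<Rightarrow> bool" where
  "invariant_set G M \<sigma> A \<longleftrightarrow>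
     A \<in> sets M \<and> (\<forall>t\<in>carrier G. measure M (sym_diff (\<sigma> t ` A) A) = 0)"

definition ergodic_action ::
    "('g, 'b) monoid_scheme \<Rightarrow> 'a measure \<Rightarrow> ('g \<Rightarrow> 'a \<Rightarrow> 'a) \<Rightarrow> bool" where
  "ergodic_action G M \<sigma> \<longleftrightarrow>
     (\<forall>A. invariant_set G M \<sigma> A \<longrightarrow> measure M A = 0 \<or> measure M (space M - A) = 0)"

definition asymptotically_invariant ::
    "('g, 'b) monoid_scheme \<Rightarrow> 'a measure \<Rightarrow> ('g \<Rightarrow> 'a \<Rightarrow> 'a) \<Rightarrow> (nat \<Rightarrow> 'a set) \<Rightarrow> bool" where
  "asymptotically_invariant G M \<sigma> A \<longleftrightarrow>
     (\<forall>n. A n \<in> sets M) \<and>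
     (\<forall>t\<in>carrier G. (\<lambda>n. measure M (sym_diff (\<sigma> t ` A n) (A n))) \<longlonglongrightarrow> 0)"

definition trivial_sequence :: "'a measure \<Rightarrow> (nat \<Rightarrow> 'a set) \<Rightarrow> bool" where
  "trivial_sequence M A \<longleftrightarrow>
     liminf (\<lambda>n. ereal (measure M (A n) * measure M (space M - A n))) = 0"

definition strongly_ergodic ::
    "('g, 'b) monoid_scheme \<Rightarrow> 'a measure \<Rightarrow> ('g \<Rightarrow> 'a \<Rightarrow> 'a) \<Rightarrow> bool" where
  "strongly_ergodic G M \<sigma> \<longleftrightarrow>
     (\<forall>A. asymptotically_invariant G M \<sigma> A \<longrightarrow> trivial_sequence M A)"

section \<open>Circle-valued functions up to a.e. equality\<close>

text \<open>The circle is the unit sphere of \<open>\<complex>\<close>; values outside \<^term>\<open>space M\<close> are irrelevant.\<close>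

definition circle_fun :: "'a measure \<Rightarrow> ('a \<Rightarrow> complex) set" where
  "circle_fun M = {f \<in> borel_measurable M. f \<in> space M \<rightarrow> sphere 0 1}"

definition ae_eq :: "'a measure \<Rightarrow> (('a \<Rightarrow> complex) \<times> ('a \<Rightarrow> complex)) set" where
  "ae_eq M = {(f, g). f \<in> circle_fun M \<and> g \<in> circle_fun M \<and> (AE x in M. f x = g x)}"

definition L0 :: "'a measure \<Rightarrow> ('a \<Rightarrow> complex) set set" where
  "L0 M = circle_fun M // ae_eq M"

definition ae_class :: "'a measure \<Rightarrow> ('a \<Rightarrow> complex) \<Rightarrow> ('a \<Rightarrow> complex) set" where
  "ae_class M f = ae_eq M `` {f}"

definition L0_basic :: "'a measure \<Rightarrow> ('a \<Rightarrow> complex) \<Rightarrow> real \<Rightarrow> ('a \<Rightarrow> complex) set set" where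
  "L0_basic M \<phi>\<^sub>0 \<epsilon> =
     {ae_class M \<phi> | \<phi>. \<phi> \<in> circle_fun M \<and> measure M {x \<in> space M. cmod (\<phi> x - \<phi>\<^sub>0 x) \<ge> \<epsilon>} < \<epsilon>}"

definition L0_topology :: "'a measure \<Rightarrow> ('a \<Rightarrow> complex) set topology" where
  "L0_topology M = topology_generated_by {L0_basic M \<phi>\<^sub>0 \<epsilon> | \<phi>\<^sub>0 \<epsilon>. \<phi>\<^sub>0 \<in> circle_fun M \<and> \<epsilon> > 0}"

section \<open>Cocycles and coboundaries\<close>

definition cocycle ::
    "('g, 'b) monoid_scheme \<Rightarrow> 'a measure \<Rightarrow> ('g \<Rightarrow> 'a \<Rightarrow> 'a) \<Rightarrow> ('g \<Rightarrow> 'a \<Rightarrow> complex) \<Rightarrow> bool" where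
  "cocycle G M \<sigma> c \<longleftrightarrow>
     (\<forall>t\<in>carrier G. c t \<in> circle_fun M) \<and>
     (\<forall>s\<in>carrier G. \<forall>t\<in>carrier G.
        AE x in M. c (s \<otimes>\<^bsub>G\<^esub> t) x = c s x * c t (\<sigma> (inv\<^bsub>G\<^esub> s) x))"

definition coboundary ::
    "('g, 'b) monoid_scheme \<Rightarrow> ('g \<Rightarrow> 'a \<Rightarrow> 'a) \<Rightarrow> ('a \<Rightarrow> complex) \<Rightarrow> 'g \<Rightarrow> 'a \<Rightarrow> complex" where
  "coboundary G \<sigma> \<phi> t x = \<phi> x / \<phi> (\<sigma> (inv\<^bsub>G\<^esub> t) x)"

text \<open>The identification of \<open>c\<close> with the family of classes of \<open>c\<^sub>t\<close> in the product of copies of \<open>L\<^sup>0\<close>.\<close>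

definition class_family ::
    "('g, 'b) monoid_scheme \<Rightarrow> 'a measure \<Rightarrow> ('g \<Rightarrow> 'a \<Rightarrow> complex) \<Rightarrow> 'g \<Rightarrow> ('a \<Rightarrow> complex) set" where
  "class_family G M c = (\<lambda>t\<in>carrier G. ae_class M (c t))"

definition Z1 ::
    "('g, 'b) monoid_scheme \<Rightarrow> 'a measure \<Rightarrow> ('g \<Rightarrow> 'a \<Rightarrow> 'a) \<Rightarrow> ('g \<Rightarrow> ('a \<Rightarrow> complex) set) set" where
  "Z1 G M \<sigma> = class_family G M ` {c. cocycle G M \<sigma> c}"

definition B1 ::
    "('g, 'b) monoid_scheme \<Rightarrow> 'a measure \<Rightarrow> ('g \<Rightarrow> 'a \<Rightarrow> 'a) \<Rightarrow> ('g \<Rightarrow> ('a \<Rightarrow> complex) set) set" where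
  "B1 G M \<sigma> = class_family G M ` coboundary G \<sigma> ` circle_fun M"

definition Z1_topology ::
    "('g, 'b) monoid_scheme \<Rightarrow> 'a measure \<Rightarrow> ('g \<Rightarrow> 'a \<Rightarrow> 'a) \<Rightarrow> ('g \<Rightarrow> ('a \<Rightarrow> complex) set) topology" where
  "Z1_topology G M \<sigma> =
     subtopology (product_topology (\<lambda>_. L0_topology M) (carrier G)) (Z1 G M \<sigma>)"

section \<open>Consistency of the definitions\<close>

lemma equiv_ae_eq: "equiv (circle_fun M) (ae_eq M)"
proof (rule equivI)
  show "ae_eq M \<subseteq> circle_fun M \<times> circle_fun M"
    by (auto simp: ae_eq_def)
  show "refl_on (circle_fun M) (ae_eq M)"
    by (auto simp: refl_on_def ae_eq_def)
  show "sym (ae_eq M)"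
    unfolding sym_def ae_eq_def by (auto simp: eq_commute)
  show "trans (ae_eq M)"
  proof (rule transI)
    fix f g h assume "(f, g) \<in> ae_eq M" "(g, h) \<in> ae_eq M"
    then show "(f, h) \<in> ae_eq M"
      unfolding ae_eq_def by (auto elim!: eventually_elim2)
  qed
qed

lemma ae_class_eq_iff:
  assumes "f \<in> circle_fun M" "g \<in> circle_fun M"
  shows "ae_class M f = ae_class M g \<longleftrightarrow> (AE x in M. f x = g x)"
  using eq_equiv_class_iff[OF equiv_ae_eq assms] assms
  by (simp add: ae_class_def ae_eq_def)

lemma ae_class_in_L0: "f \<in> circle_fun M \<Longrightarrow> ae_class M f \<in> L0 M"
  unfolding ae_class_def L0_def by (rule quotientI)

lemma ae_class_in_L0_basic_iff:
  assumes [simp]: "\<phi> \<in> circle_fun M" "\<phi>\<^sub>0 \<in> circle_fun M"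
  shows "ae_class M \<phi> \<in> L0_basic M \<phi>\<^sub>0 \<epsilon> \<longleftrightarrow>
           measure M {x \<in> space M. cmod (\<phi> x - \<phi>\<^sub>0 x) \<ge> \<epsilon>} < \<epsilon>"
proof -
  have "measure M {x \<in> space M. cmod (\<psi> x - \<phi>\<^sub>0 x) \<ge> \<epsilon>} =
        measure M {x \<in> space M. cmod (\<phi> x - \<phi>\<^sub>0 x) \<ge> \<epsilon>}"
    if \<psi>: "\<psi> \<in> circle_fun M" "ae_class M \<phi> = ae_class M \<psi>" for \<psi>
  proof (rule measure_eq_AE)
    have "AE x in M. \<phi> x = \<psi> x"
      using \<psi> by (simp add: ae_class_eq_iff)
    then show "AE x in M. x \<in> {x \<in> space M. cmod (\<psi> x - \<phi>\<^sub>0 x) \<ge> \<epsilon>} \<longleftrightarrow>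
                 x \<in> {x \<in> space M. cmod (\<phi> x - \<phi>\<^sub>0 x) \<ge> \<epsilon>}"
      by (rule AE_mp) simp
    have [measurable]: "\<phi> \<in> borel_measurable M" "\<psi> \<in> borel_measurable M" "\<phi>\<^sub>0 \<in> borel_measurable M"
      using \<psi> assms by (simp_all add: circle_fun_def)
    show "{x \<in> space M. cmod (\<psi> x - \<phi>\<^sub>0 x) \<ge> \<epsilon>} \<in> sets M"
      "{x \<in> space M. cmod (\<phi> x - \<phi>\<^sub>0 x) \<ge> \<epsilon>} \<in> sets M"
      by measurable
  qed
  note * = this
  show ?thesis
  proof
    assume "ae_class M \<phi> \<in> L0_basic M \<phi>\<^sub>0 \<epsilon>"
    then obtain \<psi> where "ae_class M \<phi> = ae_class M \<psi>" "\<psi> \<in> circle_fun M"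
      "measure M {x \<in> space M. cmod (\<psi> x - \<phi>\<^sub>0 x) \<ge> \<epsilon>} < \<epsilon>"
      unfolding L0_basic_def by blast
    then show "measure M {x \<in> space M. cmod (\<phi> x - \<phi>\<^sub>0 x) \<ge> \<epsilon>} < \<epsilon>"
      using *[of \<psi>] by simp
  next
    assume "measure M {x \<in> space M. cmod (\<phi> x - \<phi>\<^sub>0 x) \<ge> \<epsilon>} < \<epsilon>"
    then show "ae_class M \<phi> \<in> L0_basic M \<phi>\<^sub>0 \<epsilon>"
      unfolding L0_basic_def using assms(1) by blast
  qed
qed

lemma topspace_L0_topology: "topspace (L0_topology M) = L0 M"
proof
  show "topspace (L0_topology M) \<subseteq> L0 M"
    by (auto simp: L0_topology_def L0_basic_def ae_class_in_L0)
  show "L0 M \<subseteq> topspace (L0_topology M)"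
  proof
    fix X assume "X \<in> L0 M"
    then obtain f where f: "f \<in> circle_fun M" "X = ae_class M f"
      by (auto simp: L0_def ae_class_def elim: quotientE)
    then have "X \<in> L0_basic M f 1"
      by (simp add: ae_class_in_L0_basic_iff)
    with f show "X \<in> topspace (L0_topology M)"
      by (auto simp: L0_topology_def intro!: exI[of _ f] exI[of _ "1::real"] exI[of _ "L0_basic M f 1"])
  qed
qed

lemma topspace_Z1_topology: "topspace (Z1_topology G M \<sigma>) = Z1 G M \<sigma>"
proof -
  have "Z1 G M \<sigma> \<subseteq> (\<Pi>\<^sub>E t\<in>carrier G. L0 M)"
    by (auto simp: Z1_def class_family_def cocycle_def ae_class_in_L0)
  then show ?thesis
    by (simp add: Z1_topology_def topspace_L0_topology Int_absorb1)
qed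

lemma cocycle_coboundary:
  assumes "pmp_action G M \<sigma>" and \<phi>: "\<phi> \<in> circle_fun M"
  shows "cocycle G M \<sigma> (coboundary G \<sigma> \<phi>)"
proof -
  interpret group_action G "space M" \<sigma>
    using assms by (simp add: pmp_action_def)
  interpret group_hom G "BijGroup (space M)" \<sigma>
    by (rule group_hom)
  have meas: "\<sigma> t \<in> M \<rightarrow>\<^sub>M M" if "t \<in> carrier G" for t
    using assms that by (simp add: pmp_action_def)
  have \<phi>_meas: "\<phi> \<in> borel_measurable M" and \<phi>_cmod: "\<And>x. x \<in> space M \<Longrightarrow> cmod (\<phi> x) = 1"
    using \<phi> by (auto simp: circle_fun_def)
  show ?thesis
    unfolding cocycle_def
  proof (intro conjI ballI)
    fix t assume t: "t \<in> carrier G"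
    have m: "\<sigma> (inv\<^bsub>G\<^esub> t) \<in> M \<rightarrow>\<^sub>M M"
      using t by (intro meas) simp
    have "(\<lambda>x. \<phi> x / \<phi> (\<sigma> (inv\<^bsub>G\<^esub> t) x)) \<in> borel_measurable M"
      using \<phi>_meas measurable_compose[OF m \<phi>_meas] by (rule borel_measurable_divide)
    then show "coboundary G \<sigma> \<phi> t \<in> circle_fun M"
      using \<phi>_cmod measurable_space[OF m]
      by (auto simp: circle_fun_def coboundary_def[abs_def] norm_divide)
  next
    fix s t assume st: "s \<in> carrier G" "t \<in> carrier G"
    show "AE x in M. coboundary G \<sigma> \<phi> (s \<otimes>\<^bsub>G\<^esub> t) x =
            coboundary G \<sigma> \<phi> s x * coboundary G \<sigma> \<phi> t (\<sigma> (inv\<^bsub>G\<^esub> s) x)"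
    proof (rule AE_I2)
      fix x assume x: "x \<in> space M"
      have y: "\<sigma> (inv\<^bsub>G\<^esub> s) x \<in> space M"
        using st x by (intro measurable_space[OF meas]) auto
      have "\<sigma> (inv\<^bsub>G\<^esub> (s \<otimes>\<^bsub>G\<^esub> t)) x = \<sigma> (inv\<^bsub>G\<^esub> t) (\<sigma> (inv\<^bsub>G\<^esub> s) x)"
        using st x composition_rule[of x "inv\<^bsub>G\<^esub> t" "inv\<^bsub>G\<^esub> s"] by (simp add: G.inv_mult_group)
      moreover have "\<phi> (\<sigma> (inv\<^bsub>G\<^esub> s) x) \<noteq> 0"
        using \<phi>_cmod[OF y] by auto
      ultimately show "coboundary G \<sigma> \<phi> (s \<otimes>\<^bsub>G\<^esub> t) x =
            coboundary G \<sigma> \<phi> s x * coboundary G \<sigma> \<phi> t (\<sigma> (inv\<^bsub>G\<^esub> s) x)"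
        by (simp add: coboundary_def)
    qed
  qed
qed

lemma B1_subset_Z1: "pmp_action G M \<sigma> \<Longrightarrow> B1 G M \<sigma> \<subseteq> Z1 G M \<sigma>"
  unfolding B1_def Z1_def by (intro image_mono image_subsetI) (simp add: cocycle_coboundary)

end

theory Submission
  imports Defs
begin

text \<open>
  Suppose that a non-trivial asymptotically invariant sequence exists. By ergodicity its members
  \<open>B\<^sub>k\<close> cannot be uniformly almost invariant: otherwise the element of minimal norm in the closed
  convex hull of the orbit of the indicator function of \<open>B\<^sub>k\<close> would be a constant close to that
  function. So there are \<open>t\<^sub>k\<close> such that the measure of \<open>t\<^sub>k.B\<^sub>k \<triangle> B\<^sub>k\<close> is bounded below. After
  passing to a sparse subsequence, the sets \<open>t\<^sub>k.B\<^sub>m \<triangle> B\<^sub>m\<close> with \<open>m > k\<close> are negligible in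
  comparison, and the measures of \<open>s.B\<^sub>m \<triangle> B\<^sub>m\<close> are summable in \<open>m\<close> for each \<open>s\<close>.

  For every set \<open>\<theta>\<close> of natural numbers, let \<open>\<phi>\<^sub>N\<close> be the product over \<open>k \<in> \<theta>\<close>, \<open>k < N\<close>, of the
  functions equal to \<open>-1\<close> on \<open>B\<^sub>k\<close> and to \<open>1\<close> elsewhere. The coboundaries of the \<open>\<phi>\<^sub>N\<close> converge to a
  cocycle, which is the coboundary of some \<open>\<phi>\<close> if the coboundaries form a closed set. There are
  uncountably many \<open>\<theta>\<close>, so by separability two different ones, \<open>\<theta>\<close> and \<open>\<theta>'\<close>, have functions \<open>\<phi>\<close> that
  are close in measure. The two cocycles then agree at every group element off a set of small
  measure, which fails at \<open>t\<^sub>k\<close> for the least \<open>k\<close> on which \<open>\<theta>\<close> and \<open>\<theta>'\<close> differ.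
\<close>

section \<open>Measure-preserving actions\<close>

locale pmp = group_action G "space M" \<sigma> + prob_space M
  for G :: "('g, 'b) monoid_scheme" (structure) and M :: "'a measure" and \<sigma> +
  assumes pmp: "pmp_action G M \<sigma>"
begin

sublocale G: group G
  using group_hom by (simp add: group_hom_def)

abbreviation moved :: "'g \<Rightarrow> 'a set \<Rightarrow> 'a set" where
  "moved t A \<equiv> sym_diff (\<sigma> t ` A) A"

lemma act_measurable: "t \<in> carrier G \<Longrightarrow> \<sigma> t \<in> M \<rightarrow>\<^sub>M M"
  using pmp by (simp add: pmp_action_def)

lemma act_space: "t \<in> carrier G \<Longrightarrow> x \<in> space M \<Longrightarrow> \<sigma> t x \<in> space M"
  using measurable_space[OF act_measurable] .

lemma act_inv:
  assumes "t \<in> carrier G" "x \<in> space M"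
  shows "\<sigma> (inv t) (\<sigma> t x) = x" "\<sigma> t (\<sigma> (inv t) x) = x"
proof -
  have "\<sigma> \<one> x = x"
    using id_eq_one assms by (metis restrict_apply')
  then show "\<sigma> (inv t) (\<sigma> t x) = x" "\<sigma> t (\<sigma> (inv t) x) = x"
    using composition_rule[of x "inv t" t] composition_rule[of x t "inv t"] assms by simp_all
qed

lemma distr_act: "t \<in> carrier G \<Longrightarrow> distr M M (\<sigma> t) = M"
  using pmp by (simp add: pmp_action_def)

lemma integral_act:
  fixes f :: "'a \<Rightarrow> real"
  assumes "t \<in> carrier G" "f \<in> borel_measurable M"
  shows "(\<integral>x. f (\<sigma> t x) \<partial>M) = (\<integral>x. f x \<partial>M)"
  using integral_distr[OF act_measurable[OF assms(1)] assms(2)] distr_act[OF assms(1)] by simp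

lemma measure_act:
  assumes "t \<in> carrier G" "A \<in> sets M"
  shows "measure M (\<sigma> t -` A \<inter> space M) = measure M A"
  using measure_distr[OF act_measurable[OF assms(1)] assms(2)] distr_act[OF assms(1)] by simp

lemma AE_act:
  assumes t: "t \<in> carrier G" and "AE x in M. P x"
  shows "AE x in M. P (\<sigma> t x)"
proof -
  have "AE x in distr M M (\<sigma> t). P x"
    unfolding distr_act[OF t] by fact
  then show ?thesis
    by (rule AE_distrD[OF act_measurable[OF t]])
qed

text \<open>Translates are images, while measurability and \<open>distr\<close> speak of preimages;
  this passes from one to the other.\<close>

lemma image_act_eq:
  assumes "t \<in> carrier G" "A \<in> sets M"
  shows "\<sigma> t ` A = \<sigma> (inv t) -` A \<inter> space M"
proof -
  have A: "A \<subseteq> space M"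
    using assms(2) by (rule sets.sets_into_space)
  show ?thesis
  proof (intro equalityI subsetI)
    fix x assume "x \<in> \<sigma> t ` A"
    with A assms(1) show "x \<in> \<sigma> (inv t) -` A \<inter> space M"
      by (auto simp: act_inv act_space subset_iff)
  next
    fix x assume "x \<in> \<sigma> (inv t) -` A \<inter> space M"
    with assms(1) show "x \<in> \<sigma> t ` A"
      by (intro image_eqI[of _ _ "\<sigma> (inv t) x"]) (auto simp: act_inv)
  qed
qed

lemma moved_sets: "t \<in> carrier G \<Longrightarrow> A \<in> sets M \<Longrightarrow> moved t A \<in> sets M"
  using measurable_sets[OF act_measurable[of "inv t"]] by (auto simp: image_act_eq)

lemma moved_iff:
  assumes "t \<in> carrier G" "A \<in> sets M" "x \<in> space M"
  shows "x \<in> moved t A \<longleftrightarrow> (\<sigma> (inv t) x \<in> A) \<noteq> (x \<in> A)"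
  using assms by (auto simp: image_act_eq)

section \<open>Uniformly almost invariant sets\<close>

text \<open>On \<open>space M\<close> these are the convex combinations, with dyadic weights, of
  translates of the indicator function. Midpoints suffice for the parallelogram law, and translation
  invariance is built into the rules.\<close>

inductive_set orbit_hull :: "'a set \<Rightarrow> ('a \<Rightarrow> real) set" for A where
  base: "indicat_real A \<in> orbit_hull A"
| midpoint: "f \<in> orbit_hull A \<Longrightarrow> g \<in> orbit_hull A \<Longrightarrow> (\<lambda>x. (f x + g x) / 2) \<in> orbit_hull A"
| translate: "f \<in> orbit_hull A \<Longrightarrow> t \<in> carrier G \<Longrightarrow> (\<lambda>x. f (\<sigma> t x)) \<in> orbit_hull A"

lemma hull_measurable:
  assumes "A \<in> sets M" "f \<in> orbit_hull A"
  shows "f \<in> borel_measurable M"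
  using assms(2)
proof induction
  case (translate f t)
  then show ?case
    using measurable_compose[OF act_measurable] by blast
next
  case (midpoint f g)
  then have [measurable]: "f \<in> borel_measurable M" "g \<in> borel_measurable M"
    by auto
  show ?case by measurable
qed (use assms(1) in auto)

lemma hull_range:
  assumes "f \<in> orbit_hull A" "x \<in> space M"
  shows "0 \<le> f x \<and> f x \<le> 1"
  using assms
proof (induction arbitrary: x)
  case (midpoint f g)
  from midpoint.IH[OF midpoint.prems] show ?case by simp
qed (auto simp: act_space indicator_def)

lemma integrable_bounded_on_space:
  fixes f :: "'a \<Rightarrow> real"
  assumes "f \<in> borel_measurable M" "\<And>x. x \<in> space M \<Longrightarrow> \<bar>f x\<bar> \<le> B"
  shows "integrable M f"
  using assms by (intro integrable_const_bound[where B = B]) auto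

lemma hull_diff_bound:
  assumes "f \<in> orbit_hull A" "g \<in> orbit_hull A" "x \<in> space M"
  shows "\<bar>f x - g x\<bar> \<le> 1"
  using hull_range[OF assms(1,3)] hull_range[OF assms(2,3)] by linarith

lemma integrable_hull:
  assumes "A \<in> sets M" "f \<in> orbit_hull A" "g \<in> orbit_hull A"
  shows "integrable M (\<lambda>x. (f x)\<^sup>2)" "integrable M (\<lambda>x. (f x - g x)\<^sup>2)"
    "integrable M (\<lambda>x. \<bar>f x - g x\<bar>)"
proof -
  have [measurable]: "f \<in> borel_measurable M" "g \<in> borel_measurable M"
    using assms hull_measurable by auto
  have "(f x)\<^sup>2 \<le> 1" "(f x - g x)\<^sup>2 \<le> 1" if "x \<in> space M" for x
    using hull_range[OF assms(2) that] hull_diff_bound[OF assms(2,3) that]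
    by (simp_all add: abs_square_le_1)
  then show "integrable M (\<lambda>x. (f x)\<^sup>2)" "integrable M (\<lambda>x. (f x - g x)\<^sup>2)"
    "integrable M (\<lambda>x. \<bar>f x - g x\<bar>)"
    using hull_diff_bound[OF assms(2,3)]
    by (auto intro!: integrable_bounded_on_space[where B = 1])
qed

text \<open>For the indicator function itself the integrand is the indicator of
  \<open>moved (inv s) A\<close>; midpoints follow by the triangle inequality. Quantifying over
  \<open>s\<close> carries the induction through translation, which replaces \<open>s\<close> by
  \<open>t \<otimes> s\<close>.\<close>

lemma hull_L1_bound:
  assumes A: "A \<in> sets M" and \<eta>: "\<And>t. t \<in> carrier G \<Longrightarrow> measure M (moved t A) \<le> \<eta>"
    and "f \<in> orbit_hull A" "s \<in> carrier G"
  shows "(\<integral>x. \<bar>f (\<sigma> s x) - indicat_real A x\<bar> \<partial>M) \<le> \<eta>"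
  using assms(3,4)
proof (induction arbitrary: s)
  case base
  have "(\<integral>x. \<bar>indicat_real A (\<sigma> s x) - indicat_real A x\<bar> \<partial>M)
      = (\<integral>x. indicat_real (moved (inv s) A) x \<partial>M)"
    using base A moved_iff[of "inv s" A]
    by (intro Bochner_Integration.integral_cong) (auto simp: indicator_def)
  also have "\<dots> = measure M (moved (inv s) A)"
    using moved_sets[of "inv s" A] base A by (simp add: Int_absorb2 sets.sets_into_space)
  finally show ?case
    using \<eta>[of "inv s"] base by simp
next
  case (midpoint f g)
  let ?f = "\<lambda>x. f (\<sigma> s x)" and ?g = "\<lambda>x. g (\<sigma> s x)" and ?a = "indicat_real A"
  have h: "?f \<in> orbit_hull A" "?g \<in> orbit_hull A" "?a \<in> orbit_hull A"
    using midpoint by (auto intro: orbit_hull.intros)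
  have "(\<integral>x. \<bar>(?f x + ?g x) / 2 - ?a x\<bar> \<partial>M) \<le> (\<integral>x. (\<bar>?f x - ?a x\<bar> + \<bar>?g x - ?a x\<bar>) / 2 \<partial>M)"
  proof (rule integral_mono)
    show "integrable M (\<lambda>x. \<bar>(?f x + ?g x) / 2 - ?a x\<bar>)"
      using integrable_hull(3)[OF A orbit_hull.midpoint[OF h(1,2)] h(3)] .
    show "integrable M (\<lambda>x. (\<bar>?f x - ?a x\<bar> + \<bar>?g x - ?a x\<bar>) / 2)"
      using integrable_hull(3)[OF A] h by simp
  qed (simp add: field_simps abs_if)
  also have "\<dots> = ((\<integral>x. \<bar>?f x - ?a x\<bar> \<partial>M) + (\<integral>x. \<bar>?g x - ?a x\<bar> \<partial>M)) / 2"
    using integrable_hull(3)[OF A] h by simp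
  also have "\<dots> \<le> \<eta>"
    using midpoint.IH[OF midpoint.prems] by simp
  finally show ?case .
next
  case (translate f t)
  have "(\<integral>x. \<bar>f (\<sigma> t (\<sigma> s x)) - indicat_real A x\<bar> \<partial>M) = (\<integral>x. \<bar>f (\<sigma> (t \<otimes> s) x) - indicat_real A x\<bar> \<partial>M)"
    using translate by (intro Bochner_Integration.integral_cong) (auto simp: composition_rule)
  with translate show ?case by simp
qed

text \<open>Markov's inequality bounds the measure of the set where \<open>(u n x)^2\<close> is at
  least \<open>(1/4) ^ n\<close> by \<open>C * (1/4) ^ n\<close>, which is summable, so
  Borel-Cantelli applies. This yields almost everywhere limits directly from L2 estimates.\<close>

lemma AE_eventually_small:
  fixes u :: "nat \<Rightarrow> 'a \<Rightarrow> real"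
  assumes [measurable]: "\<And>n. u n \<in> borel_measurable M" and "\<And>n. integrable M (\<lambda>x. (u n x)\<^sup>2)"
    and bound: "\<And>n. (\<integral>x. (u n x)\<^sup>2 \<partial>M) \<le> C * (1/16) ^ n"
  shows "AE x in M. \<forall>\<^sub>F n in sequentially. \<bar>u n x\<bar> < (1/2) ^ n"
proof -
  let ?A = "\<lambda>n. {x \<in> space M. (1/4) ^ n \<le> (u n x)\<^sup>2}"
  have "measure M (?A n) \<le> C * (1/4) ^ n" for n
  proof -
    have "measure M (?A n) \<le> (\<integral>x. (u n x)\<^sup>2 \<partial>M) / (1/4) ^ n"
      using assms(2) by (intro integral_Markov_inequality_measure[where A = "space M"]) auto
    also have "\<dots> \<le> C * (1/16) ^ n / (1/4) ^ n"
      by (intro divide_right_mono bound) simp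
    also have "\<dots> = C * ((1/16) / (1/4)) ^ n"
      unfolding power_divide by simp
    finally show ?thesis by simp
  qed
  moreover have "summable (\<lambda>n. C * (1/4::real) ^ n)"
    by (intro summable_mult summable_geometric) simp
  ultimately have "summable (\<lambda>n. measure M (?A n))"
    by (elim summable_comparison_test'[of "\<lambda>n. C * (1/4::real) ^ n" 0]) simp
  then have "AE x in M. \<forall>\<^sub>F n in sequentially. x \<in> space M - ?A n"
    by (intro borel_cantelli_AE1) (simp_all add: emeasure_eq_measure)
  then show ?thesis
  proof (rule AE_mp, intro AE_I2 impI)
    fix x assume x: "x \<in> space M" and "\<forall>\<^sub>F n in sequentially. x \<in> space M - ?A n"
    from this(2) show "\<forall>\<^sub>F n in sequentially. \<bar>u n x\<bar> < (1/2) ^ n"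
    proof eventually_elim
      case (elim n)
      have "((1/2 :: real) ^ n)\<^sup>2 = ((1/2)\<^sup>2) ^ n"
        by (metis power_mult mult.commute)
      also have "\<dots> = (1/4) ^ n"
        by (simp add: power2_eq_square)
      finally have "\<bar>u n x\<bar>\<^sup>2 < ((1/2) ^ n)\<^sup>2"
        using elim x by simp
      then show ?case
        by (rule power2_less_imp_less) simp
    qed
  qed
qed

text \<open>By the parallelogram law, functions in the hull of nearly minimal L2 norm are close to each
  other and to their translates, so they converge to an invariant function.\<close>

lemma uniformly_almost_invariant:
  assumes A: "A \<in> sets M" and erg: "ergodic_action G M \<sigma>"
    and \<eta>: "\<And>t. t \<in> carrier G \<Longrightarrow> measure M (moved t A) \<le> \<eta>"
  shows "measure M A * measure M (space M - A) \<le> 2 * \<eta>"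
proof -
  define q where "q f = (\<integral>x. (f x)\<^sup>2 \<partial>M)" for f :: "'a \<Rightarrow> real"
  define I where "I = Inf (q ` orbit_hull A)"
  have bdd: "bdd_below (q ` orbit_hull A)"
    by (rule bdd_belowI2[where m = 0]) (simp add: q_def)
  have I_le: "I \<le> q f" if "f \<in> orbit_hull A" for f
    unfolding I_def using bdd that by (rule cINF_lower)
  \<comment> \<open>The excess \<open>(1/16) ^ n\<close> over the infimum is the rate that
    \<open>AE_eventually_small\<close> asks for.\<close>
  have "\<exists>f\<in>orbit_hull A. q f < I + (1/16) ^ n" for n
  proof -
    have "orbit_hull A \<noteq> {}" using base by blast
    moreover have "I < I + (1/16) ^ n" by simp
    ultimately show ?thesis
      unfolding I_def using bdd by (subst (asm) (1) cInf_less_iff) auto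
  qed
  then obtain f where fA: "\<And>n. f n \<in> orbit_hull A" and fI: "\<And>n. q (f n) < I + (1/16) ^ n"
    by metis
  \<comment> \<open>The midpoint is again in the hull, so its squared norm is at least
    \<open>I\<close>; with excess e the parallelogram law leaves 2(I + e) + 2(I + e) - 4I =
    4e.\<close>
  have close: "(\<integral>x. (g x - h x)\<^sup>2 \<partial>M) \<le> 4 * (1/16) ^ n"
    if gh: "g \<in> orbit_hull A" "h \<in> orbit_hull A" and "q g \<le> I + (1/16) ^ n" "q h \<le> I + (1/16) ^ n" for g h n
  proof -
    let ?m = "\<lambda>x. (g x + h x) / 2"
    have "(\<integral>x. (g x - h x)\<^sup>2 \<partial>M) = (\<integral>x. 2 * (g x)\<^sup>2 + 2 * (h x)\<^sup>2 - 4 * (?m x)\<^sup>2 \<partial>M)"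
      by (intro Bochner_Integration.integral_cong) (auto simp: power2_eq_square field_simps)
    also have "\<dots> = 2 * q g + 2 * q h - 4 * q ?m"
      unfolding q_def using integrable_hull(1)[OF A] gh orbit_hull.midpoint[OF gh]
      by (subst Bochner_Integration.integral_diff) (auto simp del: power_divide)
    finally show ?thesis
      using that I_le[OF orbit_hull.midpoint[OF gh]] by simp
  qed
  have [measurable]: "f n \<in> borel_measurable M" for n
    using hull_measurable[OF A fA] .
  have q_act: "q (\<lambda>x. f n (\<sigma> t x)) = q (f n)" if "t \<in> carrier G" for n t
    unfolding q_def using integral_act[OF that, of "\<lambda>x. (f n x)\<^sup>2"] by simp
  \<comment> \<open>\<open>lim\<close> makes \<open>F\<close> measurable on all of
    \<open>space M\<close>; almost everywhere it is the true limit, since consecutive differences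
    are dominated by a geometric series.\<close>
  define F where "F x = lim (\<lambda>n. f n x)" for x
  have [measurable]: "F \<in> borel_measurable M"
    unfolding F_def by measurable
  have "AE x in M. \<forall>\<^sub>F n in sequentially. \<bar>f (Suc n) x - f n x\<bar> < (1/2) ^ n"
  proof (rule AE_eventually_small)
    show "integrable M (\<lambda>x. (f (Suc n) x - f n x)\<^sup>2)" for n
      using integrable_hull(2)[OF A fA fA] .
    fix n
    have "q (f (Suc n)) \<le> I + (1/16) ^ n"
      using fI[of "Suc n"] power_decreasing[of n "Suc n" "1/16 :: real"] by linarith
    then show "(\<integral>x. (f (Suc n) x - f n x)\<^sup>2 \<partial>M) \<le> 4 * (1/16) ^ n"
      using fI[of n] by (intro close fA) simp_all
  qed measurable
  then have conv: "AE x in M. (\<lambda>n. f n x) \<longlonglongrightarrow> F x"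
  proof (rule AE_mp, intro AE_I2 impI)
    fix x assume "\<forall>\<^sub>F n in sequentially. \<bar>f (Suc n) x - f n x\<bar> < (1/2) ^ n"
    then have "summable (\<lambda>n. f (Suc n) x - f n x)"
      by (rule summable_comparison_test_ev[OF eventually_mono summable_geometric[of "1/2"]]) simp_all
    then have "convergent (\<lambda>n. f 0 x + (\<Sum>k<n. f (Suc k) x - f k x))"
      unfolding summable_iff_convergent by (rule convergent_add[OF convergent_const])
    then have "convergent (\<lambda>n. f n x)"
      by (subst (asm) sum_lessThan_telescope) simp
    then show "(\<lambda>n. f n x) \<longlonglongrightarrow> F x"
      unfolding F_def by (simp add: convergent_LIMSEQ_iff)
  qed
  \<comment> \<open>A translate of \<open>f n\<close> has the same norm, hence is also nearly
    minimal, and \<open>close\<close> compares it with \<open>f n\<close>.\<close>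
  have inv: "AE x in M. F (\<sigma> t x) = F x" if t: "t \<in> carrier G" for t
  proof -
    have th: "(\<lambda>x. f n (\<sigma> t x)) \<in> orbit_hull A" for n
      using fA t by (rule orbit_hull.translate)
    have "AE x in M. \<forall>\<^sub>F n in sequentially. \<bar>f n (\<sigma> t x) - f n x\<bar> < (1/2) ^ n"
    proof (rule AE_eventually_small)
      show "(\<lambda>x. f n (\<sigma> t x) - f n x) \<in> borel_measurable M" for n
        using hull_measurable[OF A th] by measurable
      show "integrable M (\<lambda>x. (f n (\<sigma> t x) - f n x)\<^sup>2)" for n
        using integrable_hull(2)[OF A th fA] .
      show "(\<integral>x. (f n (\<sigma> t x) - f n x)\<^sup>2 \<partial>M) \<le> 4 * (1/16) ^ n" for n
        using fI[of n] by (intro close fA th) (auto simp: q_act t)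
    qed
    with conv AE_act[OF t conv] show ?thesis
    proof eventually_elim
      case (elim x)
      have "(\<lambda>n. f n (\<sigma> t x) - f n x) \<longlonglongrightarrow> 0"
        by (rule Lim_null_comparison[OF eventually_mono[OF elim(3)] LIMSEQ_realpow_zero[of "1/2"]])
          simp_all
      with tendsto_diff[OF elim(2,1)] have "F (\<sigma> t x) - F x = 0"
        by (rule LIMSEQ_unique)
      then show ?case by simp
    qed
  qed
  have F01: "AE x in M. 0 \<le> F x \<and> F x \<le> 1"
    using conv
  proof (rule AE_mp, intro AE_I2 impI)
    fix x assume "x \<in> space M" "(\<lambda>n. f n x) \<longlonglongrightarrow> F x"
    then show "0 \<le> F x \<and> F x \<le> 1"
      using hull_range[OF fA] by (meson LIMSEQ_le_const LIMSEQ_le_const2)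
  qed
  have intF: "integrable M (\<lambda>x. \<bar>F x - indicat_real A x\<bar>)"
  proof (rule integrable_const_bound[where B = 1])
    show "AE x in M. norm \<bar>F x - indicat_real A x\<bar> \<le> 1"
      using F01 by (rule AE_mp) (auto simp: indicator_def intro!: AE_I2)
  qed (use A in measurable)
  have "(\<lambda>n. \<integral>x. \<bar>f n x - indicat_real A x\<bar> \<partial>M) \<longlonglongrightarrow> (\<integral>x. \<bar>F x - indicat_real A x\<bar> \<partial>M)"
  proof (rule integral_dominated_convergence[where w = "\<lambda>_. 1"])
    show "AE x in M. (\<lambda>n. \<bar>f n x - indicat_real A x\<bar>) \<longlonglongrightarrow> \<bar>F x - indicat_real A x\<bar>"
      using conv by eventually_elim (intro tendsto_intros)
    show "AE x in M. norm \<bar>f n x - indicat_real A x\<bar> \<le> 1" for n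
      using hull_diff_bound[OF fA base] by (intro AE_I2) simp
  qed (use A in auto)
  moreover have "(\<integral>x. \<bar>f n x - indicat_real A x\<bar> \<partial>M) \<le> \<eta>" for n
  proof -
    have "(\<integral>x. \<bar>f n x - indicat_real A x\<bar> \<partial>M) = (\<integral>x. \<bar>f n (\<sigma> \<one> x) - indicat_real A x\<bar> \<partial>M)"
      by (intro Bochner_Integration.integral_cong refl) (metis id_eq_one restrict_apply')
    then show ?thesis
      using hull_L1_bound[OF A \<eta> fA, of \<one>] by simp
  qed
  ultimately have F\<eta>: "(\<integral>x. \<bar>F x - indicat_real A x\<bar> \<partial>M) \<le> \<eta>"
    by (intro LIMSEQ_le_const2) auto
  \<comment> \<open>Ergodicity is applied to this one level set of \<open>F\<close>, so that
    \<open>F\<close> need not be shown to be constant.\<close>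
  define B where "B = {x \<in> space M. F x > 1/2}"
  have B: "B \<in> sets M" unfolding B_def by measurable
  have "invariant_set G M \<sigma> B"
    unfolding invariant_set_def
  proof (intro conjI ballI B)
    fix t assume t: "t \<in> carrier G"
    have "AE x in M. F (\<sigma> (inv t) x) = F x"
      using t by (intro inv) simp
    then have "AE x in M. x \<notin> moved t B"
    proof (rule AE_mp, intro AE_I2 impI)
      fix x assume "x \<in> space M" "F (\<sigma> (inv t) x) = F x"
      then show "x \<notin> moved t B"
        using act_space[of "inv t" x] t unfolding moved_iff[OF t B \<open>x \<in> space M\<close>] by (simp add: B_def)
    qed
    then show "measure M (moved t B) = 0"
      by (subst prob_eq_0[OF moved_sets[OF t B]])
  qed
  then have cases: "measure M B = 0 \<or> measure M (space M - B) = 0"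
    using erg by (simp add: ergodic_action_def)
  \<comment> \<open>Markov's inequality at the threshold 1/2, whence the factor 2.\<close>
  have lower: "measure M S \<le> 2 * \<eta>" if S: "S \<in> sets M"
    and le: "AE x in M. x \<in> S \<longrightarrow> 1/2 \<le> \<bar>F x - indicat_real A x\<bar>" for S
  proof -
    have "(\<integral>x. indicat_real S x / 2 \<partial>M) \<le> (\<integral>x. \<bar>F x - indicat_real A x\<bar> \<partial>M)"
    proof (rule integral_mono_AE[OF _ intF])
      show "integrable M (\<lambda>x. indicat_real S x / 2)"
        using S by (intro integrable_bounded_on_space[where B = 1]) (auto simp: indicator_def)
      show "AE x in M. indicat_real S x / 2 \<le> \<bar>F x - indicat_real A x\<bar>"
        using le by (rule AE_mp) (auto simp: indicator_def intro!: AE_I2)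
    qed
    then show ?thesis
      using F\<eta> S by (simp add: Int_absorb2 sets.sets_into_space)
  qed
  \<comment> \<open>If \<open>B\<close> is null, then \<open>F\<close> is at most 1/2 almost
    everywhere and so far from 1 on \<open>A\<close>; if \<open>B\<close> is co-null,
    \<open>F\<close> is far from 0 off \<open>A\<close>.\<close>
  from cases have "measure M A \<le> 2 * \<eta> \<or> measure M (space M - A) \<le> 2 * \<eta>"
  proof
    assume "measure M B = 0"
    then have "AE x in M. x \<notin> B" using B prob_eq_0 by auto
    then have "AE x in M. x \<in> A \<longrightarrow> 1/2 \<le> \<bar>F x - indicat_real A x\<bar>"
      by (rule AE_mp) (auto simp: B_def indicator_def intro!: AE_I2)
    then show ?thesis using lower[OF A] by blast
  next
    assume "measure M (space M - B) = 0"
    then have "AE x in M. x \<notin> space M - B" using B prob_eq_0[of "space M - B"] by auto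
    then have "AE x in M. x \<in> space M - A \<longrightarrow> 1/2 \<le> \<bar>F x - indicat_real A x\<bar>"
      by (rule AE_mp) (auto simp: B_def indicator_def intro!: AE_I2)
    then show ?thesis using lower[of "space M - A"] A by blast
  qed
  moreover have "measure M A * measure M (space M - A) \<le> measure M A"
    "measure M A * measure M (space M - A) \<le> measure M (space M - A)"
    by (auto intro: mult_left_le mult_left_le_one_le)
  ultimately show ?thesis by linarith
qed

end

section \<open>Circle-valued functions\<close>


lemma circle_fun_norm: "\<phi> \<in> circle_fun M \<Longrightarrow> x \<in> space M \<Longrightarrow> cmod (\<phi> x) = 1"
  by (auto simp: circle_fun_def)

text \<open>The sets of disagreement control every basic neighbourhood at once, including those not
  centred at \<open>g\<close>. Induction over the generated topology reduces the claim to
  these.\<close>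

lemma limitin_L0_topology:
  assumes "prob_space M" and f: "\<And>n. f n \<in> circle_fun M" and g: "g \<in> circle_fun M"
    and lim: "(\<lambda>n. measure M {x \<in> space M. f n x \<noteq> g x}) \<longlonglongrightarrow> 0"
  shows "limitin (L0_topology M) (\<lambda>n. ae_class M (f n)) (ae_class M g) sequentially"
proof -
  interpret prob_space M by fact
  have "\<forall>\<^sub>F n in sequentially. ae_class M (f n) \<in> U"
    if "generate_topology_on {L0_basic M \<phi>\<^sub>0 \<epsilon> | \<phi>\<^sub>0 \<epsilon>. \<phi>\<^sub>0 \<in> circle_fun M \<and> \<epsilon> > 0} U" "ae_class M g \<in> U" for U
    using that
  proof induction
    case Empty
    then show ?case by simp
  next
    case (Int a b)
    then show ?case by (auto intro: eventually_conj)
  next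
    case (UN K)
    then obtain k where k: "k \<in> K" "ae_class M g \<in> k" by blast
    then have "\<forall>\<^sub>F n in sequentially. ae_class M (f n) \<in> k" by (rule UN.IH)
    then show ?case
      by eventually_elim (use k in blast)
  next
    case (Basis s)
    then obtain h e where s: "s = L0_basic M h e" and h: "h \<in> circle_fun M" by blast
    have [measurable]: "f n \<in> borel_measurable M" "g \<in> borel_measurable M" "h \<in> borel_measurable M" for n
      using f g h by (auto simp: circle_fun_def)
    let ?S = "\<lambda>u. {x \<in> space M. e \<le> cmod (u x - h x)}"
    have "measure M (?S g) < e"
      using Basis s ae_class_in_L0_basic_iff[OF g h] by simp
    \<comment> \<open>The strict inequality in the basic set leaves room for the set where
      \<open>f n\<close> and \<open>g\<close> disagree.\<close>
    then have "\<forall>\<^sub>F n in sequentially. measure M {x \<in> space M. f n x \<noteq> g x} < e - measure M (?S g)"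
      using lim by (intro order_tendstoD(2)) auto
    then show ?case
    proof eventually_elim
      case (elim n)
      have "measure M (?S (f n)) \<le> measure M (?S g \<union> {x \<in> space M. f n x \<noteq> g x})"
        by (intro finite_measure_mono) auto
      also have "\<dots> \<le> measure M (?S g) + measure M {x \<in> space M. f n x \<noteq> g x}"
        by (intro measure_Un_le) auto
      finally show ?case
        using elim by (simp add: s ae_class_in_L0_basic_iff[OF f h])
    qed
  qed
  moreover have "generate_topology_on {L0_basic M \<phi>\<^sub>0 \<epsilon> | \<phi>\<^sub>0 \<epsilon>. \<phi>\<^sub>0 \<in> circle_fun M \<and> \<epsilon> > 0} U"
    if "openin (L0_topology M) U" for U
    using that by (simp add: L0_topology_def openin_topology_generated_by_iff)
  ultimately show ?thesis
    using ae_class_in_L0[OF g] by (simp add: limitin_def topspace_L0_topology)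
qed

text \<open>A pigeonhole argument. Cover the circle by finitely many balls of radius 1/2 and
  approximate the preimage of each ball by a member of \<open>D\<close>. This codes each function by
  one of countably many maps from \<open>C\<close> to \<open>D\<close>, so two indices share a
  code.\<close>

lemma separable_close_pair:
  fixes \<phi> :: "'i \<Rightarrow> 'a \<Rightarrow> complex"
  assumes "prob_space M" "separable_measure M" and unc: "uncountable I"
    and \<phi>: "\<And>i. i \<in> I \<Longrightarrow> \<phi> i \<in> circle_fun M" and "\<kappa> > 0"
  obtains i j where "i \<in> I" "j \<in> I" "i \<noteq> j"
    "measure M {x \<in> space M. 1 \<le> cmod (\<phi> i x - \<phi> j x)} < \<kappa>"
proof -
  interpret prob_space M by fact
  obtain D where D: "countable D" "D \<subseteq> sets M"
    and dense: "\<And>A \<epsilon>. A \<in> sets M \<Longrightarrow> \<epsilon> > 0 \<Longrightarrow> \<exists>B\<in>D. measure M (sym_diff A B) < \<epsilon>"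
    using assms(2) unfolding separable_measure_def by metis
  obtain C where C: "finite C" "sphere (0::complex) 1 \<subseteq> (\<Union>c\<in>C. ball c (1/2))"
    using compact_sphere[of "0::complex" 1] unfolding compact_eq_totally_bounded
    by (metis half_gt_zero zero_less_one)
  \<comment> \<open>Each ball contributes an error of at most \<open>2 * \<epsilon>\<close>;
    \<open>Suc\<close> makes the total strictly smaller than \<open>\<kappa>\<close>.\<close>
  define \<epsilon> where "\<epsilon> = \<kappa> / 2 / real (Suc (card C))"
  have "\<epsilon> > 0" using \<open>\<kappa> > 0\<close> by (simp add: \<epsilon>_def)
  define S where "S i c = \<phi> i -` ball c (1/2) \<inter> space M" for i c
  have S: "S i c \<in> sets M" if "i \<in> I" for i c
    unfolding S_def using \<phi>[OF that] by (intro measurable_sets) (auto simp: circle_fun_def)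
  have "\<forall>i\<in>I. \<forall>c. \<exists>B\<in>D. measure M (sym_diff (S i c) B) < \<epsilon>"
    using S dense[OF _ \<open>\<epsilon> > 0\<close>] by blast
  then obtain B where BD: "\<And>i c. i \<in> I \<Longrightarrow> B i c \<in> D"
    and B: "\<And>i c. i \<in> I \<Longrightarrow> measure M (sym_diff (S i c) (B i c)) < \<epsilon>"
    by metis
  have "\<not> inj_on (\<lambda>i. restrict (B i) C) I"
  proof
    assume "inj_on (\<lambda>i. restrict (B i) C) I"
    moreover have "(\<lambda>i. restrict (B i) C) ` I \<subseteq> (\<Pi>\<^sub>E c\<in>C. D)"
      using BD by auto
    moreover have "countable (\<Pi>\<^sub>E c\<in>C. D)"
      using C(1) D(1) by (intro countable_PiE) auto
    ultimately have "countable I"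
      by (metis countable_subset countable_image_inj_on)
    with unc show False by contradiction
  qed
  then obtain i j where ij: "i \<in> I" "j \<in> I" "i \<noteq> j" and eq: "restrict (B i) C = restrict (B j) C"
    by (auto simp: inj_on_def)
  have Beq: "B i c = B j c" if "c \<in> C" for c
    using fun_cong[OF eq, of c] that by simp
  let ?T = "\<lambda>c. sym_diff (S i c) (B i c) \<union> sym_diff (S j c) (B j c)"
  have T: "?T c \<in> sets M" for c
    using S ij BD D(2) by blast
  have "{x \<in> space M. 1 \<le> cmod (\<phi> i x - \<phi> j x)} \<subseteq> (\<Union>c\<in>C. ?T c)"
  proof
    fix x assume "x \<in> {x \<in> space M. 1 \<le> cmod (\<phi> i x - \<phi> j x)}"
    then have x: "x \<in> space M" and far: "1 \<le> dist (\<phi> i x) (\<phi> j x)" by (auto simp: dist_norm)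
    have "\<phi> i x \<in> sphere 0 1"
      using \<phi>[OF ij(1)] x by (auto simp: circle_fun_def)
    then obtain c where c: "c \<in> C" "\<phi> i x \<in> ball c (1/2)"
      using C(2) by blast
    have "\<phi> j x \<notin> ball c (1/2)"
    proof
      assume "\<phi> j x \<in> ball c (1/2)"
      then have "dist (\<phi> i x) (\<phi> j x) < 1"
        using c dist_triangle3[of "\<phi> i x" "\<phi> j x" c] by simp
      with far show False by simp
    qed
    \<comment> \<open>Here \<open>x\<close> lies in \<open>S i c\<close> but not in
      \<open>S j c\<close>, while \<open>B i c = B j c\<close>; so one of the two approximations
      errs at \<open>x\<close>.\<close>
    with c x have "x \<in> ?T c"
      using Beq[OF c(1)] by (auto simp: S_def)
    with c show "x \<in> (\<Union>c\<in>C. ?T c)" by blast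
  qed
  then have "measure M {x \<in> space M. 1 \<le> cmod (\<phi> i x - \<phi> j x)} \<le> measure M (\<Union>c\<in>C. ?T c)"
    using T C(1) by (intro finite_measure_mono sets.finite_UN) auto
  also have "\<dots> \<le> (\<Sum>c\<in>C. measure M (?T c))"
    using T C(1) by (intro finite_measure_subadditive_finite) auto
  also have "\<dots> \<le> (\<Sum>c\<in>C. \<epsilon> + \<epsilon>)"
  proof (rule sum_mono)
    fix c
    have "measure M (?T c) \<le> measure M (sym_diff (S i c) (B i c)) + measure M (sym_diff (S j c) (B j c))"
      using S ij BD D(2) by (intro measure_Un_le) blast+
    then show "measure M (?T c) \<le> \<epsilon> + \<epsilon>"
      using B[OF ij(1), of c] B[OF ij(2), of c] by linarith
  qed
  also have "\<dots> < \<kappa>"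
  proof -
    have "2 * \<epsilon> * real (Suc (card C)) = \<kappa>"
      by (simp add: \<epsilon>_def del: of_nat_Suc)
    with \<open>\<epsilon> > 0\<close> show ?thesis
      by (simp add: algebra_simps)
  qed
  finally show ?thesis
    using that ij by blast
qed

text \<open>Transfers closeness of two circle-valued functions to their coboundaries, which are
  quotients of their values at two points.\<close>

lemma cmod_quotient_diff_le:
  assumes "cmod a = 1" "cmod b = 1" "cmod a' = 1" "cmod b' = 1"
  shows "cmod (a / b - a' / b') \<le> cmod (a - a') + cmod (b - b')"
proof -
  have "b \<noteq> 0" "b' \<noteq> 0"
    using assms by auto
  then have "a / b - a' / b' = (a - a') / b + a' * (b' - b) / (b * b')"
    by (simp add: divide_simps) (simp add: algebra_simps)
  also have "cmod \<dots> \<le> cmod (a - a') + cmod (b - b')"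
    using assms by (intro order_trans[OF norm_triangle_ineq]) (simp add: norm_mult norm_divide norm_minus_commute)
  finally show ?thesis .
qed

lemma uncountable_UNIV_nat_set: "uncountable (UNIV :: nat set set)"
proof
  assume "countable (UNIV :: nat set set)"
  then have "range (from_nat_into (UNIV :: nat set set)) = Pow UNIV"
    by (simp add: range_from_nat_into)
  with Cantors_theorem show False by metis
qed

section \<open>Limits of coboundaries\<close>

context pmp
begin


definition sign_prod :: "(nat \<Rightarrow> 'a set) \<Rightarrow> nat set \<Rightarrow> nat \<Rightarrow> 'a \<Rightarrow> complex" where
  "sign_prod B \<theta> N x = (\<Prod>k<N. if k \<in> \<theta> \<and> x \<in> B k then -1 else 1)"

lemma sign_prod_circle_fun:
  assumes [measurable]: "\<And>k. B k \<in> sets M"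
  shows "sign_prod B \<theta> N \<in> circle_fun M"
proof -
  have "cmod (sign_prod B \<theta> N x) = 1" for x
    unfolding sign_prod_def prod_norm[symmetric] by (intro prod.neutral) auto
  moreover have "sign_prod B \<theta> N \<in> borel_measurable M"
    unfolding sign_prod_def[abs_def] by measurable
  ultimately show ?thesis
    by (auto simp: circle_fun_def)
qed

lemma coboundary_circle_fun:
  "\<phi> \<in> circle_fun M \<Longrightarrow> t \<in> carrier G \<Longrightarrow> coboundary G \<sigma> \<phi> t \<in> circle_fun M"
  using cocycle_coboundary[OF pmp] by (simp add: cocycle_def)

text \<open>A quotient of two signs is -1 exactly when they differ, that is, when one of
  \<open>x\<close> and \<open>\<sigma> (inv t) x\<close> lies in \<open>B k\<close> and the other
  does not.\<close>

lemma coboundary_sign_prod: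
  assumes B: "\<And>k. B k \<in> sets M" and "t \<in> carrier G" "x \<in> space M"
  shows "coboundary G \<sigma> (sign_prod B \<theta> N) t x
    = (\<Prod>k<N. if k \<in> \<theta> \<and> x \<in> moved t (B k) then -1 else 1)"
  unfolding coboundary_def sign_prod_def prod_dividef[symmetric] moved_iff[OF assms(2) B assms(3)]
  by (intro prod.cong refl) auto

text \<open>The value of \<^const>\<open>lim\<close> is arbitrary where the sequence diverges; the case distinction keeps
  it on the circle.\<close>

definition sign_cocycle :: "(nat \<Rightarrow> 'a set) \<Rightarrow> nat set \<Rightarrow> 'g \<Rightarrow> 'a \<Rightarrow> complex" where
  "sign_cocycle B \<theta> t x =
     (let l = lim (\<lambda>N. coboundary G \<sigma> (sign_prod B \<theta> N) t x) in if cmod l = 1 then l else 1)"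

lemma sign_cocycle_circle_fun:
  assumes B: "\<And>k. B k \<in> sets M" and t: "t \<in> carrier G"
  shows "sign_cocycle B \<theta> t \<in> circle_fun M"
proof -
  have [measurable]: "coboundary G \<sigma> (sign_prod B \<theta> N) t \<in> borel_measurable M" for N
    using coboundary_circle_fun[OF sign_prod_circle_fun[of B, OF B] t] by (auto simp: circle_fun_def)
  have "sign_cocycle B \<theta> t \<in> borel_measurable M"
    unfolding sign_cocycle_def[abs_def] Let_def by measurable
  then show ?thesis
    by (auto simp: circle_fun_def sign_cocycle_def Let_def)
qed

text \<open>From index \<open>N\<close> on every factor of the coboundary is 1 at \<open>x\<close>,
  so the sequence is constant there and attains its limit.\<close>

lemma sign_cocycle_eq:
  assumes B: "\<And>k. B k \<in> sets M" and t: "t \<in> carrier G" and x: "x \<in> space M"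
    and stable: "\<And>k. N \<le> k \<Longrightarrow> x \<notin> moved t (B k)"
    and "N \<le> m"
  shows "sign_cocycle B \<theta> t x = coboundary G \<sigma> (sign_prod B \<theta> m) t x"
proof -
  let ?c = "\<lambda>m. coboundary G \<sigma> (sign_prod B \<theta> m) t x"
  have const: "?c m = ?c N" if "N \<le> m" for m
    unfolding coboundary_sign_prod[of B, OF B t x] using that stable
    by (intro prod.mono_neutral_right) auto
  then have "\<forall>\<^sub>F m in sequentially. ?c m = ?c N"
    by (rule eventually_sequentiallyI)
  then have "?c \<longlonglongrightarrow> ?c N"
    by (rule tendsto_eventually)
  moreover have "cmod (?c N) = 1"
    using coboundary_circle_fun[OF sign_prod_circle_fun[of B, OF B] t] x by (rule circle_fun_norm)
  ultimately show ?thesis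
    using const[OF \<open>N \<le> m\<close>] by (simp add: sign_cocycle_def limI)
qed

lemma AE_finitely_often_moved:
  assumes B: "\<And>k. B k \<in> sets M" and t: "t \<in> carrier G"
    and "summable (\<lambda>k. measure M (moved t (B k)))"
  shows "AE x in M. \<exists>N. \<forall>k\<ge>N. x \<notin> moved t (B k)"
proof -
  have "AE x in M. \<forall>\<^sub>F k in sequentially. x \<in> space M - moved t (B k)"
    using assms(3) moved_sets[OF t B] by (intro borel_cantelli_AE1) (simp_all add: emeasure_eq_measure)
  then show ?thesis
    by (rule AE_mp) (intro AE_I2, auto simp: eventually_sequentially)
qed

text \<open>The identity holds for every partial product, and at almost every point all three
  sequences involved are constant from a common index \<open>m\<close> on.\<close>

lemma cocycle_sign_cocycle:
  assumes B: "\<And>k. B k \<in> sets M"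
    and sum: "\<And>t. t \<in> carrier G \<Longrightarrow> summable (\<lambda>k. measure M (moved t (B k)))"
  shows "cocycle G M \<sigma> (sign_cocycle B \<theta>)"
  unfolding cocycle_def
proof (intro conjI ballI sign_cocycle_circle_fun[of B, OF B])
  fix s t assume st: "s \<in> carrier G" "t \<in> carrier G"
  then have g: "s \<otimes> t \<in> carrier G" "inv s \<in> carrier G" by auto
  let ?P = "\<lambda>t x. \<exists>N. \<forall>k\<ge>N. x \<notin> moved t (B k)"
  have 1: "AE x in M. ?P s x" "AE x in M. ?P (s \<otimes> t) x" "AE x in M. ?P t x"
    using AE_finitely_often_moved[of B, OF B _ sum] st g by auto
  \<comment> \<open>The last factor is evaluated at \<open>\<sigma> (inv s) x\<close>; measure
    preservation pulls its exceptional null set back.\<close>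
  have 2: "AE x in M. ?P t (\<sigma> (inv s) x)"
    using AE_act[OF g(2) 1(3)] .
  have "AE x in M. \<forall>N. coboundary G \<sigma> (sign_prod B \<theta> N) (s \<otimes> t) x =
      coboundary G \<sigma> (sign_prod B \<theta> N) s x * coboundary G \<sigma> (sign_prod B \<theta> N) t (\<sigma> (inv s) x)"
    unfolding AE_all_countable
    using cocycle_coboundary[OF pmp sign_prod_circle_fun[of B, OF B]] st by (simp add: cocycle_def)
  with 1(1,2) 2 AE_space
  show "AE x in M. sign_cocycle B \<theta> (s \<otimes> t) x = sign_cocycle B \<theta> s x * sign_cocycle B \<theta> t (\<sigma> (inv s) x)"
  proof eventually_elim
    case (elim x)
    obtain N1 N2 N3 where N: "\<And>k. k \<ge> N1 \<Longrightarrow> x \<notin> moved s (B k)" "\<And>k. k \<ge> N2 \<Longrightarrow> x \<notin> moved (s \<otimes> t) (B k)"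
       "\<And>k. k \<ge> N3 \<Longrightarrow> \<sigma> (inv s) x \<notin> moved t (B k)"
      using elim by metis
    define m where "m = N1 + N2 + N3"
    have "sign_cocycle B \<theta> s x = coboundary G \<sigma> (sign_prod B \<theta> m) s x"
      by (rule sign_cocycle_eq[of B, OF B st(1) \<open>x \<in> space M\<close> N(1)]) (auto simp: m_def)
    moreover have "sign_cocycle B \<theta> (s \<otimes> t) x = coboundary G \<sigma> (sign_prod B \<theta> m) (s \<otimes> t) x"
      by (rule sign_cocycle_eq[of B, OF B g(1) \<open>x \<in> space M\<close> N(2)]) (auto simp: m_def)
    moreover have "sign_cocycle B \<theta> t (\<sigma> (inv s) x) = coboundary G \<sigma> (sign_prod B \<theta> m) t (\<sigma> (inv s) x)"
      by (rule sign_cocycle_eq[of B, OF B st(2) act_space[OF g(2) \<open>x \<in> space M\<close>] N(3)]) (auto simp: m_def)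
    ultimately show ?case using elim by simp
  qed
qed

lemma measure_UN_moved_le:
  assumes B: "\<And>k. B k \<in> sets M" and t: "t \<in> carrier G"
    and sum: "summable (\<lambda>k. measure M (moved t (B k)))"
  shows "measure M (\<Union>k. moved t (B (k + N))) \<le> (\<Sum>k. measure M (moved t (B (k + N))))"
  using moved_sets[OF t B] summable_ignore_initial_segment[OF sum]
  by (intro finite_measure_subadditive_countably) blast+

text \<open>At each \<open>t\<close>, the coboundary of the \<open>N\<close>-th partial product
  differs from the limit only on the union of the moved sets with index at least \<open>N\<close>,
  whose measure is bounded by the tail of a convergent series. This gives convergence in every
  coordinate of the product topology.\<close>

lemma sign_cocycle_is_coboundary:
  assumes closed: "closedin (Z1_topology G M \<sigma>) (B1 G M \<sigma>)" and B: "\<And>k. B k \<in> sets M"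
    and sum: "\<And>t. t \<in> carrier G \<Longrightarrow> summable (\<lambda>k. measure M (moved t (B k)))"
  obtains \<phi> where "\<phi> \<in> circle_fun M"
    "\<And>t. t \<in> carrier G \<Longrightarrow> AE x in M. sign_cocycle B \<theta> t x = coboundary G \<sigma> \<phi> t x"
proof -
  let ?b = "\<lambda>N. coboundary G \<sigma> (sign_prod B \<theta> N)" and ?c = "sign_cocycle B \<theta>"
  have b: "cocycle G M \<sigma> (?b N)" for N
    using cocycle_coboundary[OF pmp sign_prod_circle_fun[of B, OF B]] .
  have inB: "class_family G M (?b N) \<in> B1 G M \<sigma>" for N
    unfolding B1_def using sign_prod_circle_fun[of B, OF B] by blast
  have inZ: "class_family G M (?b N) \<in> Z1 G M \<sigma>" for N
    unfolding Z1_def using b by blast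
  have "limitin (Z1_topology G M \<sigma>) (\<lambda>N. class_family G M (?b N)) (class_family G M ?c) sequentially"
    unfolding Z1_topology_def limitin_subtopology limitin_componentwise
  proof (intro conjI ballI)
    show "class_family G M ?c \<in> Z1 G M \<sigma>"
      unfolding Z1_def using cocycle_sign_cocycle[of B, OF B sum] by blast
    show "\<forall>\<^sub>F N in sequentially. class_family G M (?b N) \<in> Z1 G M \<sigma>"
      using inZ by simp
    show "class_family G M ?c \<in> extensional (carrier G)"
      by (simp add: class_family_def)
    show "\<forall>\<^sub>F N in sequentially. class_family G M (?b N)
        \<in> topspace (product_topology (\<lambda>_. L0_topology M) (carrier G))"
      using b by (auto simp: topspace_L0_topology class_family_def cocycle_def ae_class_in_L0)
    fix t assume t: "t \<in> carrier G"
    have "limitin (L0_topology M) (\<lambda>N. ae_class M (?b N t)) (ae_class M (?c t)) sequentially"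
    proof (rule limitin_L0_topology[OF prob_space_axioms])
      show "?b N t \<in> circle_fun M" for N
        using coboundary_circle_fun[OF sign_prod_circle_fun[of B, OF B] t] .
      show "?c t \<in> circle_fun M"
        using sign_cocycle_circle_fun[of B, OF B t] .
      let ?U = "\<lambda>N. \<Union>k. moved t (B (k + N))"
      have "{x \<in> space M. ?b N t x \<noteq> ?c t x} \<subseteq> ?U N" for N
      proof (intro subsetI, rule ccontr)
        fix x assume x: "x \<in> {x \<in> space M. ?b N t x \<noteq> ?c t x}" and "x \<notin> ?U N"
        then have "x \<notin> moved t (B (k + N))" for k by blast
        then have "x \<notin> moved t (B k)" if "N \<le> k" for k
          by (metis le_add_diff_inverse2 that)
        then have "?c t x = ?b N t x"
          using x by (intro sign_cocycle_eq[of B, OF B t]) auto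
        with x show False by simp
      qed
      then have "measure M {x \<in> space M. ?b N t x \<noteq> ?c t x} \<le> measure M (?U N)" for N
        using moved_sets[OF t B] by (intro finite_measure_mono sets.countable_UN') auto
      then have "measure M {x \<in> space M. ?b N t x \<noteq> ?c t x} \<le> (\<Sum>k. measure M (moved t (B (k + N))))" for N
        using measure_UN_moved_le[of B, OF B t sum[OF t], of N] order_trans by blast
      then show "(\<lambda>N. measure M {x \<in> space M. ?b N t x \<noteq> ?c t x}) \<longlonglongrightarrow> 0"
        by (intro tendsto_sandwich[OF _ _ tendsto_const suminf_exist_split2[OF sum[OF t]]]) auto
    qed
    then show "limitin (L0_topology M) (\<lambda>N. class_family G M (?b N) t) (class_family G M ?c t) sequentially"
      using t by (simp add: class_family_def)
  qed
  then have "class_family G M ?c \<in> B1 G M \<sigma>"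
    using closed inB by (rule_tac limitin_closedin) auto
  then obtain \<phi> where \<phi>: "\<phi> \<in> circle_fun M" "class_family G M ?c = class_family G M (coboundary G \<sigma> \<phi>)"
    by (auto simp: B1_def)
  have "AE x in M. ?c t x = coboundary G \<sigma> \<phi> t x" if t: "t \<in> carrier G" for t
    using fun_cong[OF \<phi>(2), of t] t
      ae_class_eq_iff[OF sign_cocycle_circle_fun[of B, OF B t] coboundary_circle_fun[OF \<phi>(1) t]]
    by (simp add: class_family_def)
  with \<phi>(1) that show ?thesis by blast
qed

section \<open>Failure of closedness\<close>

text \<open>The sets removed in the last hypothesis are those on which factors of index above
  \<open>k\<close> could change the sign of the cocycle at \<open>t k\<close>. On what remains, that
  sign is determined by the indices up to \<open>k\<close>.\<close>

lemma B1_not_closed: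
  assumes sep: "separable_measure M" and B: "\<And>k. B k \<in> sets M"
    and sum: "\<And>s. s \<in> carrier G \<Longrightarrow> summable (\<lambda>k. measure M (moved s (B k)))"
    and t: "\<And>k. t k \<in> carrier G" and "\<gamma> > 0"
    and \<gamma>: "\<And>k. \<gamma> \<le> measure M (moved (t k) (B k) - (\<Union>m\<in>{k<..}. moved (t k) (B m)))"
  shows "\<not> closedin (Z1_topology G M \<sigma>) (B1 G M \<sigma>)"
proof
  assume closed: "closedin (Z1_topology G M \<sigma>) (B1 G M \<sigma>)"
  have "\<exists>\<phi>. \<phi> \<in> circle_fun M \<and> (\<forall>s\<in>carrier G. AE x in M. sign_cocycle B \<theta> s x = coboundary G \<sigma> \<phi> s x)" for \<theta>
    using sign_cocycle_is_coboundary[of B, OF closed B sum, of \<theta>] by metis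
  then obtain \<phi> where \<phi>: "\<And>\<theta>. \<phi> \<theta> \<in> circle_fun M"
    and eq: "\<And>\<theta> s. s \<in> carrier G \<Longrightarrow> AE x in M. sign_cocycle B \<theta> s x = coboundary G \<sigma> (\<phi> \<theta>) s x"
    by metis
  \<comment> \<open>The bound is \<open>\<gamma> / 2\<close> because a coboundary at
    \<open>t k\<close> sees both the bad set \<open>?P\<close> and its translate
    \<open>?Q\<close>.\<close>
  obtain \<theta> \<theta>' :: "nat set" where "\<theta> \<noteq> \<theta>'"
    and close: "measure M {x \<in> space M. 1 \<le> cmod (\<phi> \<theta> x - \<phi> \<theta>' x)} < \<gamma> / 2"
    using separable_close_pair[where \<phi> = \<phi> and \<kappa> = "\<gamma> / 2",
        OF prob_space_axioms sep uncountable_UNIV_nat_set \<phi>] \<open>\<gamma> > 0\<close> by auto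
  define k where "k = (LEAST k. (k \<in> \<theta>) \<noteq> (k \<in> \<theta>'))"
  have k: "(k \<in> \<theta>) \<noteq> (k \<in> \<theta>')"
    unfolding k_def by (rule LeastI_ex) (use \<open>\<theta> \<noteq> \<theta>'\<close> in blast)
  have less_k: "j \<in> \<theta> \<longleftrightarrow> j \<in> \<theta>'" if "j < k" for j
    using not_less_Least that unfolding k_def by blast
  let ?D = "moved (t k) (B k) - (\<Union>m\<in>{k<..}. moved (t k) (B m))"
  let ?P = "{x \<in> space M. 1 \<le> cmod (\<phi> \<theta> x - \<phi> \<theta>' x)}"
  let ?Q = "\<sigma> (inv (t k)) -` ?P \<inter> space M"
  have it: "inv (t k) \<in> carrier G" using t by simp
  have [measurable]: "\<phi> \<theta> \<in> borel_measurable M" for \<theta>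
    using \<phi> by (simp add: circle_fun_def)
  have P: "?P \<in> sets M" by measurable
  have Q: "?Q \<in> sets M"
    using act_measurable[OF it] P by (rule measurable_sets)
  have D: "?D \<in> sets M"
    using moved_sets[OF t B] by (intro sets.Diff sets.countable_UN') auto
  \<comment> \<open>Used with the common product \<open>p = q\<close> of the factors below
    \<open>k\<close>: the factor at \<open>k\<close> has opposite signs in the two cocycles, so they
    differ by plus or minus \<open>2 * p\<close>.\<close>
  have double: "cmod z = 2" if "p = q" "cmod p = 1" "z \<in> {p + q, - p - q}" for p q z
  proof -
    have "z = 2 * p \<or> z = - (2 * p)"
      using that by auto
    then show ?thesis
      using that(2) by (auto simp: norm_mult)
  qed
  \<comment> \<open>Off \<open>?P\<close> and \<open>?Q\<close> both pairs of values are at distance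
    below 1, so the coboundaries differ by less than 2; on \<open>?D\<close> the cocycles differ by
    exactly 2.\<close>
  have "AE x in M. x \<in> ?D \<longrightarrow> x \<in> ?P \<union> ?Q"
    using eq[OF t, of \<theta> k] eq[OF t, of \<theta>' k] AE_space
  proof eventually_elim
    case (elim x)
    show ?case
    proof (intro impI, rule ccontr)
      assume xD: "x \<in> ?D" and nx: "x \<notin> ?P \<union> ?Q"
      have y: "\<sigma> (inv (t k)) x \<in> space M"
        using act_space[OF it] elim by blast
      have stable: "x \<notin> moved (t k) (B m)" if "Suc k \<le> m" for m
        using xD that by auto
      let ?v = "\<lambda>\<theta>. \<Prod>j<k. if j \<in> \<theta> \<and> x \<in> moved (t k) (B j) then -1 else (1::complex)"
      have v: "sign_cocycle B \<theta> (t k) x = (if k \<in> \<theta> then - ?v \<theta> else ?v \<theta>)" for \<theta>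
      proof -
        have "sign_cocycle B \<theta> (t k) x = coboundary G \<sigma> (sign_prod B \<theta> (Suc k)) (t k) x"
          by (rule sign_cocycle_eq[of B, OF B t elim(3)]) (erule stable, rule order_refl)
        also have "\<dots> = (if k \<in> \<theta> then - ?v \<theta> else ?v \<theta>)"
          unfolding coboundary_sign_prod[of B, OF B t elim(3)] using xD by simp
        finally show ?thesis .
      qed
      have "?v \<theta> = ?v \<theta>'"
        using less_k by (intro prod.cong) auto
      moreover have "cmod (?v \<theta>) = 1"
        unfolding prod_norm[symmetric] by (intro prod.neutral) auto
      moreover have "sign_cocycle B \<theta> (t k) x - sign_cocycle B \<theta>' (t k) x \<in> {?v \<theta> + ?v \<theta>', - ?v \<theta> - ?v \<theta>'}"
        unfolding v using k by auto
      ultimately have "cmod (sign_cocycle B \<theta> (t k) x - sign_cocycle B \<theta>' (t k) x) = 2"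
        by (rule double)
      moreover have "cmod (\<phi> \<theta> x / \<phi> \<theta> (\<sigma> (inv (t k)) x) - \<phi> \<theta>' x / \<phi> \<theta>' (\<sigma> (inv (t k)) x)) < 2"
        using cmod_quotient_diff_le[OF circle_fun_norm circle_fun_norm circle_fun_norm circle_fun_norm,
            OF \<phi>[of \<theta>] elim(3) \<phi>[of \<theta>] y \<phi>[of \<theta>'] elim(3) \<phi>[of \<theta>'] y] nx y elim(3)
        by auto
      ultimately show False
        using elim by (simp add: coboundary_def)
    qed
  qed
  then have "measure M ?D \<le> measure M (?P \<union> ?Q)"
    using P Q by (intro finite_measure_mono_AE) auto
  also have "\<dots> \<le> measure M ?P + measure M ?Q"
    using P Q by (rule measure_Un_le)
  also have "\<dots> = 2 * measure M ?P"
    using measure_act[OF it P] by simp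
  finally show False
    using close \<gamma>[of k] by linarith
qed

text \<open>Each late set is moved substantially by some group element, by the contrapositive of
  \<open>uniformly_almost_invariant\<close>. Asymptotic invariance then allows a subsequence so
  sparse that later sets are hardly moved by the elements chosen earlier.\<close>

lemma non_strongly_ergodic_sequence:
  assumes countable: "countable (carrier G)" and erg: "ergodic_action G M \<sigma>"
    and inv: "asymptotically_invariant G M \<sigma> A" and nontriv: "\<not> trivial_sequence M A"
  obtains B t \<gamma> where "\<And>k. B k \<in> sets M"
    "\<And>s. s \<in> carrier G \<Longrightarrow> summable (\<lambda>k. measure M (moved s (B k)))"
    "\<And>k. t k \<in> carrier G" "\<gamma> > 0"
    "\<And>k. \<gamma> \<le> measure M (moved (t k) (B k) - (\<Union>m\<in>{k<..}. moved (t k) (B m)))"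
proof -
  let ?a = "\<lambda>n. ereal (measure M (A n) * measure M (space M - A n))"
  have "0 \<le> liminf ?a"
    by (intro Liminf_bounded always_eventually) simp
  then have "0 < liminf ?a"
    using nontriv by (simp add: trivial_sequence_def less_le)
  then obtain \<delta> where \<delta>: "0 < ereal \<delta>" "ereal \<delta> < liminf ?a"
    using ereal_dense2 by blast
  then obtain n0 where n0: "\<And>n. n0 \<le> n \<Longrightarrow> \<delta> < measure M (A n) * measure M (space M - A n)"
    using less_LiminfD[OF \<delta>(2)] by (auto simp: eventually_sequentially)
  have \<delta>0: "0 < \<delta>" using \<delta> by simp
  \<comment> \<open>A positive \<open>liminf\<close> bounds all late terms below, so dropping the
    first \<open>n0\<close> sets makes the bound \<open>\<delta>\<close> uniform.\<close>
  define A' where "A' n = A (n + n0)" for n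
  have A': "A' n \<in> sets M" for n
    using inv by (simp add: asymptotically_invariant_def A'_def)
  have lim: "(\<lambda>n. measure M (moved s (A' n))) \<longlonglongrightarrow> 0" if "s \<in> carrier G" for s
    unfolding A'_def using inv that
    by (intro LIMSEQ_ignore_initial_segment[where f = "\<lambda>n. measure M (moved s (A n))"])
      (simp add: asymptotically_invariant_def)
  \<comment> \<open>Otherwise \<open>uniformly_almost_invariant\<close> would bound the product of
    measures by \<open>\<delta> / 2\<close>.\<close>
  have "\<exists>s\<in>carrier G. \<delta> / 4 < measure M (moved s (A' n))" for n
  proof (rule ccontr)
    assume "\<not> ?thesis"
    then have "measure M (A' n) * measure M (space M - A' n) \<le> 2 * (\<delta> / 4)"
      by (intro uniformly_almost_invariant[OF A' erg]) (simp add: not_less)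
    with n0[of "n + n0"] \<delta>0 show False by (simp add: A'_def)
  qed
  then obtain u where u: "\<And>n. u n \<in> carrier G" "\<And>n. \<delta> / 4 < measure M (moved (u n) (A' n))"
    by metis
  \<comment> \<open>The enumerated elements give summability for every group element; the elements
    \<open>u\<close> make later sets negligible at the chosen \<open>t k\<close>.\<close>
  define F where "F k n = from_nat_into (carrier G) ` {..k} \<union> u ` {..n}" for k n :: nat
  have F: "F k n \<subseteq> carrier G" "finite (F k n)" for k n
    using u(1) from_nat_into[of "carrier G"] G.one_closed by (auto simp: F_def)
  \<comment> \<open>\<open>True\<close> fills the invariant slot of
    \<open>dependent_nat_choice\<close>. The bounds sum to \<open>\<delta> / 16\<close>, which
    leaves more than \<open>\<delta> / 8\<close> of the initial \<open>\<delta> / 4\<close>.\<close>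
  have "\<exists>r. \<forall>k. True \<and> r k < r (Suc k) \<and>
      (\<forall>s\<in>F k (r k). measure M (moved s (A' (r (Suc k)))) < \<delta> / 32 * (1/2) ^ k)"
  proof (intro dependent_nat_choice)
    fix n k :: nat
    have "\<forall>\<^sub>F m in sequentially. measure M (moved s (A' m)) < \<delta> / 32 * (1/2) ^ k" if "s \<in> F k n" for s
      using that F(1) \<delta>0 by (intro order_tendstoD(2)[OF lim]) auto
    then have "\<forall>\<^sub>F m in sequentially. n < m \<and> (\<forall>s\<in>F k n. measure M (moved s (A' m)) < \<delta> / 32 * (1/2) ^ k)"
      by (intro eventually_conj eventually_gt_at_top eventually_ball_finite F(2)) blast
    then show "\<exists>m. True \<and> n < m \<and> (\<forall>s\<in>F k n. measure M (moved s (A' m)) < \<delta> / 32 * (1/2) ^ k)"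
      using eventually_happens'[OF sequentially_bot] by blast
  qed simp
  then obtain r where r: "\<And>k. r k < r (Suc k)"
    and rF: "\<And>k s. s \<in> F k (r k) \<Longrightarrow> measure M (moved s (A' (r (Suc k)))) < \<delta> / 32 * (1/2) ^ k"
    by blast
  have mono: "F k (r k) \<subseteq> F m (r m)" if "k \<le> m" for k m
  proof -
    have "r k \<le> r m"
      using lift_Suc_mono_le[of r] r that less_imp_le by blast
    with that show ?thesis
      unfolding F_def by (intro Un_mono image_mono) auto
  qed
  have bound: "measure M (moved s (A' (r (Suc m)))) \<le> \<delta> / 32 * (1/2) ^ m" if "s \<in> F k (r k)" "k \<le> m" for s k m
    using rF[of s m] mono[OF that(2)] that(1) by (meson less_imp_le subsetD)
  have geo: "summable (\<lambda>m. \<delta> / 32 * (1/2) ^ m)"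
    by (intro summable_mult summable_geometric) simp
  have sum: "summable (\<lambda>m. measure M (moved s (A' (r m))))" if s: "s \<in> F k (r k)" for s k
  proof -
    have "summable (\<lambda>m. measure M (moved s (A' (r (Suc m)))))"
      by (rule summable_comparison_test'[OF geo, of k]) (use bound[OF s] in simp)
    then show ?thesis
      by (subst (asm) summable_Suc_iff)
  qed
  show ?thesis
  proof (rule that[of "\<lambda>k. A' (r k)" "\<lambda>k. u (r k)" "\<delta> / 8"])
    show "summable (\<lambda>k. measure M (moved s (A' (r k))))" if s: "s \<in> carrier G" for s
    proof -
      obtain k where "s = from_nat_into (carrier G) k"
        using from_nat_into_surj[OF countable s] by metis
      then have "s \<in> F k (r k)"
        by (simp add: F_def)
      then show ?thesis by (rule sum)
    qed
    fix k
    let ?m = "\<lambda>j. moved (u (r k)) (A' (r j))"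
    let ?U = "\<Union>j. ?m (j + Suc k)"
    have uF: "u (r k) \<in> F k (r k)"
      by (simp add: F_def)
    have m: "?m j \<in> sets M" for j
      using u(1) A' by (rule moved_sets)
    have U_sets: "?U \<in> sets M"
      using m by blast
    have sums: "summable (\<lambda>j. measure M (?m (j + Suc k)))"
      using sum[OF uF] by (rule summable_ignore_initial_segment)
    have "measure M ?U \<le> (\<Sum>j. measure M (?m (j + Suc k)))"
      by (rule measure_UN_moved_le[OF A' u(1) sum[OF uF]])
    also have "\<dots> \<le> (\<Sum>j. \<delta> / 32 * (1/2) ^ j)"
    proof (rule suminf_le[OF _ sums geo])
      fix j
      have "measure M (?m (Suc (j + k))) \<le> \<delta> / 32 * (1/2) ^ (j + k)"
        by (rule bound[OF uF]) simp
      also have "\<dots> \<le> \<delta> / 32 * (1/2) ^ j"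
        using \<delta>0 by (intro mult_left_mono power_decreasing) auto
      finally show "measure M (?m (j + Suc k)) \<le> \<delta> / 32 * (1/2) ^ j"
        by simp
    qed
    also have "\<dots> = \<delta> / 16"
      by (subst suminf_mult) (simp_all add: suminf_geometric)
    finally have U: "measure M ?U \<le> \<delta> / 16" .
    have "{k<..} = range (\<lambda>j. j + Suc k)"
      by (auto simp: image_iff dest: less_imp_Suc_add)
    then have "(\<Union>j\<in>{k<..}. ?m j) = ?U"
      by (simp only: image_image SUP_UNION UN_simps)
    moreover have "measure M (?m k) \<le> measure M ((?m k - ?U) \<union> ?U)"
      by (rule finite_measure_mono[OF _ sets.Un[OF sets.Diff[OF m U_sets] U_sets]]) blast
    moreover have "\<dots> \<le> measure M (?m k - ?U) + measure M ?U"
      by (rule measure_Un_le[OF sets.Diff[OF m U_sets] U_sets])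
    ultimately show "\<delta> / 8 \<le> measure M (?m k - (\<Union>j\<in>{k<..}. ?m j))"
      using U u(2)[of "r k"] \<delta>0 by simp
  qed (use A' u(1) \<delta>0 in auto)
qed

end

theorem theorem4:
  fixes G :: "('g, 'b) monoid_scheme" and M :: "'a measure" and \<sigma> :: "'g \<Rightarrow> 'a \<Rightarrow> 'a"
  assumes "group G" and "countable (carrier G)"
    and "prob_space M" and "separable_measure M"
    and "pmp_action G M \<sigma>" and "ergodic_action G M \<sigma>"
    and "closedin (Z1_topology G M \<sigma>) (B1 G M \<sigma>)"
  shows "strongly_ergodic G M \<sigma>"
proof (rule ccontr)
  assume "\<not> strongly_ergodic G M \<sigma>"
  then obtain A where A: "asymptotically_invariant G M \<sigma> A" "\<not> trivial_sequence M A"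
    by (auto simp: strongly_ergodic_def)
  interpret pmp G M \<sigma>
    using assms(5) by (intro pmp.intro pmp_axioms.intro assms(3)) (simp_all add: pmp_action_def)
  show False
    by (rule non_strongly_ergodic_sequence[OF assms(2,6) A])
      (use B1_not_closed[OF assms(4)] assms(7) in blast)
qed

end
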